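(* Let $n\ge 1$ and let $a,b,c,d,a_1,b_1,\dots,a_n,b_n\in\mathbb{C}$. Put $\alpha=(a_1,b_1,\dots,a_n,b_n)$, $\theta=\begin{pmatrix} a& b\\ c& d\end{pmatrix}$, $\Theta=\mathrm{diag}\{\theta,\dots,\theta\}$ (block diagonal with $n$ blocks), and let $$D(a,b,c,d;\alpha):=\begin{pmatrix} ad-bc & \alpha\\ 0&\Theta\end{pmatrix}$$ be the resulting block matrix of size $2n+1$. Then $D(a,b,c,d;\alpha)\in\mathrm{HLie}_m(\mathfrak{h}_{2n+1}(\mathbb{C}))$.
   Context: $\mathfrak{h}_{2n+1}(\mathbb{C})$ is the complex Heisenberg Lie algebra with basis $z,x_1,y_1,x_2,y_2,\dots,x_n,y_n$ and brackets $[x_i,y_j]=\delta_{ij}z$, $[x_i,z]=[y_j,z]=0$, $[x_i,x_j]=[y_i,y_j]=0$. Matrices of size $2n+1$ are identified with linear maps of $\mathfrak{h}_{2n+1}(\mathbb{C})$ with respect to the ordered basis $(z,x_1,y_1,\dots,x_n,y_n)$, the columns being the images of the basis vectors; thus $D=D(a,b,c,d;\alpha)$ acts by $D(z)=(ad-bc)z$, $D(x_i)=a_iz+ax_i+cy_i$, $D(y_i)=b_iz+bx_i+dy_i$. A linear map $D:\mathfrak{g}\to\mathfrak{g}$ on a finite-dimensional complex Lie algebra $\mathfrak{g}$ is a Hom-Lie algebra structure on $\mathfrak{g}$ if $[D(x),[y,w]]+[D(y),[w,x]]+[D(w),[x,y]]=0$ for all $x,y,w\in\mathfrak{g}$; it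 is multiplicative if moreover $D([x,y])=[D(x),D(y)]$ for all $x,y\in\mathfrak{g}$. $\mathrm{HLie}_m(\mathfrak{g})$ is the set of all multiplicative Hom-Lie algebra structures on $\mathfrak{g}$. *)

theory Defs
  imports "Jordan_Normal_Form.VS_Connect"
begin

section \<open>Multiplicative Hom-Lie structures on finite-dimensional complex Lie algebras\<close>

text \<open>The record fields \<open>mult\<close> and \<open>one\<close> of \<open>g\<close> play no role; the Lie bracket
  is a separate parameter, and all its laws are relative to the carrier of \<open>g\<close>.\<close>

locale complex_lie_algebra = vectorspace class_ring g
  for g :: "(complex, 'v) module" +
  fixes bracket :: "'v \<Rightarrow> 'v \<Rightarrow> 'v"
  assumes finite_dimensional: "fin_dim"
    and bracket_closed:
      "\<lbrakk>x \<in> carrier g; y \<in> carrier g\<rbrakk> \<Longrightarrow> bracket x y \<in> carrier g"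
    and bracket_add_left:
      "\<lbrakk>x \<in> carrier g; y \<in> carrier g; w \<in> carrier g\<rbrakk> \<Longrightarrow>
        bracket (x \<oplus>\<^bsub>g\<^esub> y) w = bracket x w \<oplus>\<^bsub>g\<^esub> bracket y w"
    and bracket_add_right:
      "\<lbrakk>x \<in> carrier g; y \<in> carrier g; w \<in> carrier g\<rbrakk> \<Longrightarrow>
        bracket x (y \<oplus>\<^bsub>g\<^esub> w) = bracket x y \<oplus>\<^bsub>g\<^esub> bracket x w"
    and bracket_smult_left:
      "\<lbrakk>x \<in> carrier g; y \<in> carrier g\<rbrakk> \<Longrightarrow>
        bracket (r \<odot>\<^bsub>g\<^esub> x) y = r \<odot>\<^bsub>g\<^esub> bracket x y"
    and bracket_smult_right:
      "\<lbrakk>x \<in> carrier g; y \<in> carrier g\<rbrakk> \<Longrightarrow>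
        bracket x (r \<odot>\<^bsub>g\<^esub> y) = r \<odot>\<^bsub>g\<^esub> bracket x y"
    and bracket_self: "x \<in> carrier g \<Longrightarrow> bracket x x = \<zero>\<^bsub>g\<^esub>"
    and jacobi:
      "\<lbrakk>x \<in> carrier g; y \<in> carrier g; w \<in> carrier g\<rbrakk> \<Longrightarrow>
        bracket x (bracket y w) \<oplus>\<^bsub>g\<^esub> bracket y (bracket w x) \<oplus>\<^bsub>g\<^esub> bracket w (bracket x y)
          = \<zero>\<^bsub>g\<^esub>"
begin

definition hom_lie_structure :: "('v \<Rightarrow> 'v) \<Rightarrow> bool" where
  "hom_lie_structure D \<longleftrightarrow>
    linear_map class_ring g g D \<and>
    (\<forall>x\<in>carrier g. \<forall>y\<in>carrier g. \<forall>w\<in>carrier g.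
      bracket (D x) (bracket y w) \<oplus>\<^bsub>g\<^esub> bracket (D y) (bracket w x)
        \<oplus>\<^bsub>g\<^esub> bracket (D w) (bracket x y) = \<zero>\<^bsub>g\<^esub>)"

definition multiplicative :: "('v \<Rightarrow> 'v) \<Rightarrow> bool" where
  "multiplicative D \<longleftrightarrow>
    (\<forall>x\<in>carrier g. \<forall>y\<in>carrier g. D (bracket x y) = bracket (D x) (D y))"

definition HLie_m :: "('v \<Rightarrow> 'v) set" where
  "HLie_m = {D. hom_lie_structure D \<and> multiplicative D}"

end

section \<open>The Heisenberg Lie algebra\<close>

text \<open>The underlying space is the coordinate space of dimension \<open>2n+1\<close>; its standard basis,
  in this order, is \<open>z, x\<^sub>1, y\<^sub>1, \<dots>, x\<^sub>n, y\<^sub>n\<close>. Positions are counted from 0, while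
  the index \<open>i\<close> of \<open>x\<^sub>i\<close> and \<open>y\<^sub>i\<close> ranges over \<open>{1..n}\<close>.\<close>

abbreviation heis_space :: "nat \<Rightarrow> (complex, complex vec) module" where
  "heis_space n \<equiv> module_vec TYPE(complex) (2 * n + 1)"

definition heis_z :: "nat \<Rightarrow> complex vec" where
  "heis_z n = unit_vec (2 * n + 1) 0"

definition heis_x :: "nat \<Rightarrow> nat \<Rightarrow> complex vec" where
  "heis_x n i = unit_vec (2 * n + 1) (2 * i - 1)"

definition heis_y :: "nat \<Rightarrow> nat \<Rightarrow> complex vec" where
  "heis_y n i = unit_vec (2 * n + 1) (2 * i)"

text \<open>The bilinear extension of \<open>[x\<^sub>i, y\<^sub>j] = \<delta>\<^sub>i\<^sub>j z = - [y\<^sub>j, x\<^sub>i]\<close>, all other brackets of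
  basis vectors being zero; see \<open>heis_bracket_basis\<close> below.\<close>

definition heis_bracket :: "nat \<Rightarrow> complex vec \<Rightarrow> complex vec \<Rightarrow> complex vec" where
  "heis_bracket n u v =
    (\<Sum>i = 1..n. u $ (2 * i - 1) * v $ (2 * i) - u $ (2 * i) * v $ (2 * i - 1)) \<cdot>\<^sub>v heis_z n"

abbreviation heis_HLie_m :: "nat \<Rightarrow> (complex vec \<Rightarrow> complex vec) set" where
  "heis_HLie_m n \<equiv> complex_lie_algebra.HLie_m (heis_space n) (heis_bracket n)"

lemma heis_bracket_carrier [simp]: "heis_bracket n u v \<in> carrier_vec (2 * n + 1)"
  by (simp add: heis_bracket_def heis_z_def)

lemma heis_bracket_index:
  "k < 2 * n + 1 \<Longrightarrow> heis_bracket n u v $ k =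
    (if k = 0 then \<Sum>i = 1..n. u $ (2 * i - 1) * v $ (2 * i) - u $ (2 * i) * v $ (2 * i - 1)
     else 0)"
  by (simp add: heis_bracket_def heis_z_def)

lemma heis_bracket_nested [simp]: "heis_bracket n u (heis_bracket n v w) = 0\<^sub>v (2 * n + 1)"
proof -
  have "(\<Sum>i = 1..n. u $ (2 * i - 1) * heis_bracket n v w $ (2 * i)
      - u $ (2 * i) * heis_bracket n v w $ (2 * i - 1)) = 0"
    by (rule sum.neutral) (auto simp: heis_bracket_index)
  then show ?thesis
    unfolding heis_bracket_def[of n u] heis_z_def by (intro eq_vecI) auto
qed

theorem heis_lie_algebra: "complex_lie_algebra (heis_space n) (heis_bracket n)"
proof -
  interpret vec_space "TYPE(complex)" "2 * n + 1" .
  define \<omega> :: "complex vec \<Rightarrow> complex vec \<Rightarrow> complex" where "\<omega> u v =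
    (\<Sum>i = 1..n. u $ (2 * i - 1) * v $ (2 * i) - u $ (2 * i) * v $ (2 * i - 1))" for u v
  have br: "heis_bracket n u v = \<omega> u v \<cdot>\<^sub>v heis_z n" for u v
    by (simp add: heis_bracket_def \<omega>_def)
  have z: "heis_z n \<in> carrier_vec (2 * n + 1)"
    by (simp add: heis_z_def)
  have entry: "(u + v) $ k = u $ k + v $ k" "(r \<cdot>\<^sub>v v) $ k = r * v $ k"
    if "v \<in> carrier_vec (2 * n + 1)" "k \<le> 2 * n" for u v :: "complex vec" and k r
    using that by auto
  have le: "2 * i - 1 \<le> 2 * n" "2 * i \<le> 2 * n" if "i \<in> {1..n}" for i
    using that by auto
  have add: "\<omega> (u + v) w = \<omega> u w + \<omega> v w" "\<omega> w (u + v) = \<omega> w u + \<omega> w v"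
    if "v \<in> carrier_vec (2 * n + 1)" for u v w
    unfolding \<omega>_def sum.distrib[symmetric]
    by (rule sum.cong[OF refl], simp only: entry[OF that] le, simp add: algebra_simps)+
  have smult: "\<omega> (r \<cdot>\<^sub>v v) w = r * \<omega> v w" "\<omega> w (r \<cdot>\<^sub>v v) = r * \<omega> w v"
    if "v \<in> carrier_vec (2 * n + 1)" for r v w
    unfolding \<omega>_def sum_distrib_left
    by (rule sum.cong[OF refl], simp only: entry[OF that] le, simp add: algebra_simps)+
  have self: "\<omega> v v = 0" for v
    by (simp add: \<omega>_def algebra_simps)
  have zero: "(0::complex) \<cdot>\<^sub>v heis_z n = 0\<^sub>v (2 * n + 1)"
    using z by (intro eq_vecI) auto
  show ?thesis
  proof (unfold_locales, unfold module_vec_simps, goal_cases)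
    case 1
    show ?case by (rule fin_dim)
  next
    case 2
    show ?case by (rule heis_bracket_carrier)
  next
    case 3
    then show ?case by (simp only: br add add_smult_distrib_vec)
  next
    case 4
    then show ?case by (simp only: br add add_smult_distrib_vec)
  next
    case 5
    then show ?case by (simp only: br smult smult_smult_assoc)
  next
    case 6
    then show ?case by (simp only: br smult smult_smult_assoc)
  next
    case 7
    show ?case by (simp only: br self zero)
  next
    case 8
    show ?case by (simp only: heis_bracket_nested) simp
  qed
qed

theorem heis_bracket_basis:
  assumes "i \<in> {1..n}" "j \<in> {1..n}"
  shows "heis_bracket n (heis_x n i) (heis_y n j) = (if i = j then 1 else 0) \<cdot>\<^sub>v heis_z n"
    and "heis_bracket n (heis_x n i) (heis_z n) = 0\<^sub>v (2 * n + 1)"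
    and "heis_bracket n (heis_y n j) (heis_z n) = 0\<^sub>v (2 * n + 1)"
    and "heis_bracket n (heis_x n i) (heis_x n j) = 0\<^sub>v (2 * n + 1)"
    and "heis_bracket n (heis_y n i) (heis_y n j) = 0\<^sub>v (2 * n + 1)"
proof -
  have parity: "2 * k - Suc 0 \<noteq> 2 * l" if "1 \<le> k" for k l :: nat
    using that by presburger
  have odd_eq: "2 * k - Suc 0 = 2 * l - Suc 0 \<longleftrightarrow> k = l" if "1 \<le> k" "1 \<le> l" for k l :: nat
    using that by presburger
  have X: "heis_x n i $ (2 * k - 1) = (if k = i then 1 else 0)" "heis_x n i $ (2 * k) = 0"
    if "i \<in> {1..n}" "k \<in> {1..n}" for i k
    using that parity[of i k] odd_eq[of k i] by (auto simp: heis_x_def)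
  have Y: "heis_y n i $ (2 * k) = (if k = i then 1 else 0)" "heis_y n i $ (2 * k - 1) = 0"
    if "i \<in> {1..n}" "k \<in> {1..n}" for i k
    using that parity[of k i] by (auto simp: heis_y_def)
  have Z: "heis_z n $ (2 * k) = 0" "heis_z n $ (2 * k - 1) = 0" if "k \<in> {1..n}" for k
    using that by (auto simp: heis_z_def)
  have zero: "(0::complex) \<cdot>\<^sub>v heis_z n = 0\<^sub>v (2 * n + 1)"
    by (intro eq_vecI) (auto simp: heis_z_def)
  have "(\<Sum>k = 1..n. heis_x n i $ (2 * k - 1) * heis_y n j $ (2 * k)
      - heis_x n i $ (2 * k) * heis_y n j $ (2 * k - 1))
      = (\<Sum>k = 1..n. if k = i then (if i = j then 1 else 0) else 0)"
    by (rule sum.cong[OF refl], simp only: X Y assms) auto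
  then show "heis_bracket n (heis_x n i) (heis_y n j) = (if i = j then 1 else 0) \<cdot>\<^sub>v heis_z n"
    using assms unfolding heis_bracket_def by simp
  have "(\<Sum>k = 1..n. heis_x n i $ (2 * k - 1) * heis_z n $ (2 * k)
      - heis_x n i $ (2 * k) * heis_z n $ (2 * k - 1)) = 0"
    by (rule sum.neutral, intro ballI, simp only: Z) simp
  then show "heis_bracket n (heis_x n i) (heis_z n) = 0\<^sub>v (2 * n + 1)"
    unfolding heis_bracket_def by (simp only: zero)
  have "(\<Sum>k = 1..n. heis_y n j $ (2 * k - 1) * heis_z n $ (2 * k)
      - heis_y n j $ (2 * k) * heis_z n $ (2 * k - 1)) = 0"
    by (rule sum.neutral, intro ballI, simp only: Z) simp
  then show "heis_bracket n (heis_y n j) (heis_z n) = 0\<^sub>v (2 * n + 1)"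
    unfolding heis_bracket_def by (simp only: zero)
  have "(\<Sum>k = 1..n. heis_x n i $ (2 * k - 1) * heis_x n j $ (2 * k)
      - heis_x n i $ (2 * k) * heis_x n j $ (2 * k - 1)) = 0"
    by (rule sum.neutral, intro ballI, simp only: X assms) simp
  then show "heis_bracket n (heis_x n i) (heis_x n j) = 0\<^sub>v (2 * n + 1)"
    unfolding heis_bracket_def by (simp only: zero)
  have "(\<Sum>k = 1..n. heis_y n i $ (2 * k - 1) * heis_y n j $ (2 * k)
      - heis_y n i $ (2 * k) * heis_y n j $ (2 * k - 1)) = 0"
    by (rule sum.neutral, intro ballI, simp only: Y assms) simp
  then show "heis_bracket n (heis_y n i) (heis_y n j) = 0\<^sub>v (2 * n + 1)"
    unfolding heis_bracket_def by (simp only: zero)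
qed

section \<open>The block matrices\<close>

definition heis_theta :: "complex \<Rightarrow> complex \<Rightarrow> complex \<Rightarrow> complex \<Rightarrow> complex mat" where
  "heis_theta a b c d = mat_of_rows_list 2 [[a, b], [c, d]]"

text \<open>The row \<open>(a\<^sub>1, b\<^sub>1, \<dots>, a\<^sub>n, b\<^sub>n)\<close>.\<close>

definition heis_alpha :: "nat \<Rightarrow> (nat \<Rightarrow> complex) \<Rightarrow> (nat \<Rightarrow> complex) \<Rightarrow> complex vec" where
  "heis_alpha n as bs = vec_of_list (concat (map (\<lambda>i. [as i, bs i]) [1..<n + 1]))"

definition heis_D ::
  "nat \<Rightarrow> complex \<Rightarrow> complex \<Rightarrow> complex \<Rightarrow> complex \<Rightarrow> complex vec \<Rightarrow> complex mat" where
  "heis_D n a b c d \<alpha> =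
    four_block_mat
      (mat_of_rows_list 1 [[a * d - b * c]]) (mat_of_rows (2 * n) [\<alpha>])
      (0\<^sub>m (2 * n) 1)                        (diag_block_mat (replicate n (heis_theta a b c d)))"

lemma heis_theta_carrier [simp]: "heis_theta a b c d \<in> carrier_mat 2 2"
  by (simp add: heis_theta_def mat_of_rows_list_def numeral_2_eq_2)

lemma heis_theta_dim [simp]:
  "dim_row (heis_theta a b c d) = 2" "dim_col (heis_theta a b c d) = 2"
  by (simp_all add: heis_theta_def mat_of_rows_list_def)

lemma heis_diag_dim [simp]:
  "dim_row (diag_block_mat (replicate n (heis_theta a b c d))) = 2 * n"
  "dim_col (diag_block_mat (replicate n (heis_theta a b c d))) = 2 * n"
  by (simp_all add: dim_diag_block_mat sum_list_replicate)

theorem heis_D_carrier: "heis_D n a b c d \<alpha> \<in> carrier_mat (2 * n + 1) (2 * n + 1)"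
  unfolding carrier_mat_def heis_D_def by (simp add: mat_of_rows_list_def)

lemma heis_diag_index:
  assumes "r < 2 * n" "s < 2 * n"
  shows "diag_block_mat (replicate n (heis_theta a b c d)) $$ (r, s) =
    (if r div 2 = s div 2 then heis_theta a b c d $$ (r mod 2, s mod 2) else 0)"
  using assms
proof (induction n arbitrary: r s)
  case 0
  then show ?case by simp
next
  case (Suc n)
  have div2: "k div 2 = Suc ((k - 2) div 2)" "k mod 2 = (k - 2) mod 2" if "\<not> k < 2" for k :: nat
    using that by presburger+
  show ?case
    using Suc.prems Suc.IH[of "r - 2" "s - 2"]
    by (cases "r < 2"; cases "s < 2") (auto simp: Let_def div2)
qed

lemma heis_alpha_index:
  assumes "i \<in> {1..n}"
  shows "heis_alpha n as bs $ (2 * i - 2) = as i" "heis_alpha n as bs $ (2 * i - 1) = bs i"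
proof -
  have len: "length (concat (map (\<lambda>i. [as i, bs i]) [1..<n + 1])) = 2 * n" for n
    by (induction n) auto
  have "concat (map (\<lambda>i. [as i, bs i]) [1..<n + 1]) ! (2 * i - 2) = as i \<and>
        concat (map (\<lambda>i. [as i, bs i]) [1..<n + 1]) ! (2 * i - 1) = bs i"
    using assms
  proof (induction n)
    case 0
    then show ?case by simp
  next
    case (Suc n)
    have app: "concat (map (\<lambda>i. [as i, bs i]) [1..<Suc n + 1])
        = concat (map (\<lambda>i. [as i, bs i]) [1..<n + 1]) @ [as (Suc n), bs (Suc n)]"
      by simp
    show ?case
    proof (cases "i = Suc n")
      case True
      show ?thesis unfolding app nth_append len True by simp
    next
      case False
      then have i: "i \<in> {1..n}" "2 * i - 2 < 2 * n" "2 * i - 1 < 2 * n" using Suc.prems by auto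
      show ?thesis unfolding app nth_append len using Suc.IH[OF i(1)] i by simp
    qed
  qed
  then show "heis_alpha n as bs $ (2 * i - 2) = as i" "heis_alpha n as bs $ (2 * i - 1) = bs i"
    by (simp_all add: heis_alpha_def vec_of_list_index)
qed

lemma heis_D_index:
  assumes "k < 2 * n + 1" "j < 2 * n + 1"
  shows "heis_D n a b c d \<alpha> $$ (k, j) =
    (if k = 0 then (if j = 0 then a * d - b * c else \<alpha> $ (j - 1))
     else if j = 0 then 0
     else if (k - 1) div 2 = (j - 1) div 2
       then heis_theta a b c d $$ ((k - 1) mod 2, (j - 1) mod 2) else 0)"
  using assms heis_diag_index[of "k - 1" n "j - 1" a b c d]
  by (auto simp: heis_D_def mat_of_rows_list_def mat_of_rows_def)

lemma heis_D_unit_vec: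
  assumes "j < 2 * n + 1"
  shows "heis_D n a b c d \<alpha> *\<^sub>v unit_vec (2 * n + 1) j = col (heis_D n a b c d \<alpha>) j"
  using assms heis_D_carrier[of n a b c d \<alpha>] by (intro eq_vecI) auto

lemma heis_theta_index:
  "heis_theta a b c d $$ (0, 0) = a" "heis_theta a b c d $$ (0, Suc 0) = b"
  "heis_theta a b c d $$ (Suc 0, 0) = c" "heis_theta a b c d $$ (Suc 0, Suc 0) = d"
  by (simp_all add: heis_theta_def mat_of_rows_list_def)

theorem heis_D_basis:
  fixes a b c d :: complex and as bs :: "nat \<Rightarrow> complex"
  assumes i: "i \<in> {1..n}"
  defines "D \<equiv> heis_D n a b c d (heis_alpha n as bs)"
  shows "D *\<^sub>v heis_z n = (a * d - b * c) \<cdot>\<^sub>v heis_z n"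
    and "D *\<^sub>v heis_x n i = as i \<cdot>\<^sub>v heis_z n + a \<cdot>\<^sub>v heis_x n i + c \<cdot>\<^sub>v heis_y n i"
    and "D *\<^sub>v heis_y n i = bs i \<cdot>\<^sub>v heis_z n + b \<cdot>\<^sub>v heis_x n i + d \<cdot>\<^sub>v heis_y n i"
proof -
  note carr = heis_D_carrier[of n a b c d "heis_alpha n as bs", folded D_def]
  obtain m where m: "i = Suc m" "m < n" using i by (cases i) auto
  have dv: "(k - 1) div 2 = m \<longleftrightarrow> k = 2 * m + 1 \<or> k = 2 * m + 2" if "k \<noteq> 0" for k :: nat
    using that by presburger
  note alpha = heis_alpha_index[OF i, of as bs, unfolded m]
  show "D *\<^sub>v heis_z n = (a * d - b * c) \<cdot>\<^sub>v heis_z n"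
    unfolding heis_z_def D_def
    by (subst heis_D_unit_vec, simp, intro eq_vecI)
       (use carr in \<open>auto simp: D_def heis_D_index\<close>)
  show "D *\<^sub>v heis_x n i = as i \<cdot>\<^sub>v heis_z n + a \<cdot>\<^sub>v heis_x n i + c \<cdot>\<^sub>v heis_y n i"
    unfolding heis_x_def heis_y_def heis_z_def D_def
    by (subst heis_D_unit_vec, use m in simp, intro eq_vecI)
       (use carr m alpha dv in \<open>auto simp: D_def heis_D_index heis_theta_index\<close>)
  show "D *\<^sub>v heis_y n i = bs i \<cdot>\<^sub>v heis_z n + b \<cdot>\<^sub>v heis_x n i + d \<cdot>\<^sub>v heis_y n i"
    unfolding heis_x_def heis_y_def heis_z_def D_def
    by (subst heis_D_unit_vec, use m in simp, intro eq_vecI)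
       (use carr m alpha dv in \<open>auto simp: D_def heis_D_index heis_theta_index\<close>)
qed

end

theory Submission
  imports Defs
begin

text \<open>The derived algebra of the Heisenberg algebra is spanned by the central element \<open>z\<close>, so every
  term \<open>[D x, [y, w]]\<close> of the Hom-Jacobi identity vanishes by itself, whatever \<open>D\<close> is; only
  multiplicativity says something about \<open>D\<close>.  The bracket is \<open>[u, v] = \<omega>(u, v) z\<close>, where \<open>\<omega>\<close> is
  a sum of \<open>n\<close> two-dimensional determinants, the \<open>i\<close>-th one formed from the coordinates of \<open>u\<close> and
  \<open>v\<close> along \<open>x\<^sub>i\<close> and \<open>y\<^sub>i\<close>.  On each of these coordinate planes \<open>D\<close> acts by the same matrix \<open>\<theta>\<close>
  (\<open>heis_D_mult_vec_index\<close>), hence multiplies each determinant by \<open>det \<theta> = a d - b c\<close>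
  (\<open>heis_bracket_heis_D\<close>).  Since \<open>D\<close> also multiplies \<open>z\<close> by \<open>a d - b c\<close>, it respects the bracket;
  this is why that number has to stand in the upper left corner.  The row \<open>\<alpha>\<close> only adds multiples
  of \<open>z\<close>, which the bracket does not see.\<close>

lemma heis_D_mult_vec_index:
  fixes \<alpha> v :: "complex vec"
  assumes i: "i \<in> {1..n}" and v: "v \<in> carrier_vec (2 * n + 1)"
  shows "(heis_D n a b c d \<alpha> *\<^sub>v v) $ (2 * i - 1) = a * v $ (2 * i - 1) + b * v $ (2 * i)"
    and "(heis_D n a b c d \<alpha> *\<^sub>v v) $ (2 * i) = c * v $ (2 * i - 1) + d * v $ (2 * i)"
proof -
  let ?D = "heis_D n a b c d \<alpha>"
  obtain m where m: "i = Suc m" "m < n" using i by (cases i) auto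
  have block: "(j - 1) div 2 = m \<longleftrightarrow> j = 2 * m + 1 \<or> j = 2 * m + 2" if "j \<noteq> 0" for j :: nat
    using that by presburger
  \<comment> \<open>Rows \<open>2 i - 1\<close> and \<open>2 i\<close> vanish outside the \<open>i\<close>-th diagonal block, so only two summands survive.\<close>
  have row: "(?D *\<^sub>v v) $ k =
      ?D $$ (k, 2 * m + 1) * v $ (2 * m + 1) + ?D $$ (k, 2 * m + 2) * v $ (2 * m + 2)"
    if k: "k = 2 * m + 1 \<or> k = 2 * m + 2" for k
  proof -
    have k': "k < 2 * n + 1" "k \<noteq> 0" "(k - 1) div 2 = m"
      using k m by auto
    have "(?D *\<^sub>v v) $ k = (\<Sum>j = 0..<2 * n + 1. ?D $$ (k, j) * v $ j)"
      using heis_D_carrier[of n a b c d \<alpha>] v k' by (simp add: scalar_prod_def)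
    also have "\<dots> = (\<Sum>j\<in>{2 * m + 1, 2 * m + 2}. ?D $$ (k, j) * v $ j)"
    proof (rule sum.mono_neutral_right)
      show "\<forall>j\<in>{0..<2 * n + 1} - {2 * m + 1, 2 * m + 2}. ?D $$ (k, j) * v $ j = 0"
      proof
        fix j assume j: "j \<in> {0..<2 * n + 1} - {2 * m + 1, 2 * m + 2}"
        then have "j = 0 \<or> (j - 1) div 2 \<noteq> m" using block[of j] by auto
        then show "?D $$ (k, j) * v $ j = 0"
          using j k' by (auto simp: heis_D_index)
      qed
    qed (use m in auto)
    finally show ?thesis by simp
  qed
  show "(?D *\<^sub>v v) $ (2 * i - 1) = a * v $ (2 * i - 1) + b * v $ (2 * i)"
    using row[of "2 * m + 1"] m by (simp add: heis_D_index heis_theta_index)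
  show "(?D *\<^sub>v v) $ (2 * i) = c * v $ (2 * i - 1) + d * v $ (2 * i)"
    using row[of "2 * m + 2"] m by (simp add: heis_D_index heis_theta_index)
qed

text \<open>Applying \<open>\<theta>\<close> to both columns of a two-dimensional determinant multiplies it by \<open>det \<theta>\<close>, and all
  \<open>n\<close> summands of the bracket are multiplied by the same number because all blocks are equal.\<close>

lemma heis_bracket_heis_D:
  assumes u: "u \<in> carrier_vec (2 * n + 1)" and v: "v \<in> carrier_vec (2 * n + 1)"
  shows "heis_bracket n (heis_D n a b c d \<alpha> *\<^sub>v u) (heis_D n a b c d \<alpha> *\<^sub>v v)
    = (a * d - b * c) \<cdot>\<^sub>v heis_bracket n u v"
proof -
  let ?D = "heis_D n a b c d \<alpha>"
  have "(\<Sum>i = 1..n. (?D *\<^sub>v u) $ (2 * i - 1) * (?D *\<^sub>v v) $ (2 * i)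
        - (?D *\<^sub>v u) $ (2 * i) * (?D *\<^sub>v v) $ (2 * i - 1))
      = (a * d - b * c) * (\<Sum>i = 1..n. u $ (2 * i - 1) * v $ (2 * i) - u $ (2 * i) * v $ (2 * i - 1))"
    unfolding sum_distrib_left
    by (rule sum.cong[OF refl], simp only: heis_D_mult_vec_index u v, simp add: algebra_simps)
  then show ?thesis
    by (simp only: heis_bracket_def smult_smult_assoc)
qed

lemma linear_map_mult_mat_vec:
  fixes A :: "'a :: field mat"
  assumes A: "A \<in> carrier_mat m n"
  shows "linear_map class_ring (module_vec TYPE('a) n) (module_vec TYPE('a) m) (\<lambda>v. A *\<^sub>v v)"
proof -
  interpret V: vec_space "TYPE('a)" n .
  interpret W: vec_space "TYPE('a)" m .
  have "(\<lambda>v. A *\<^sub>v v) \<in> LinearCombinations.module_hom class_ring (module_vec TYPE('a) n) (module_vec TYPE('a) m)"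
    using A unfolding LinearCombinations.module_hom_def module_vec_simps
    by (auto simp: mult_add_distrib_mat_vec mult_mat_vec)
  then show ?thesis
    by unfold_locales
qed

theorem proposition4p2:
  fixes n :: nat and a b c d :: complex and as bs :: "nat \<Rightarrow> complex"
  assumes "n \<ge> 1"
  shows "(\<lambda>v. heis_D n a b c d (heis_alpha n as bs) *\<^sub>v v) \<in> heis_HLie_m n"
proof -
  interpret complex_lie_algebra "heis_space n" "heis_bracket n"
    by (rule heis_lie_algebra)
  let ?D = "heis_D n a b c d (heis_alpha n as bs)"
  have "hom_lie_structure (\<lambda>v. ?D *\<^sub>v v)"
    unfolding hom_lie_structure_def
    by (simp add: linear_map_mult_mat_vec[OF heis_D_carrier] module_vec_simps del: One_nat_def)
  moreover have "?D *\<^sub>v heis_bracket n u v = heis_bracket n (?D *\<^sub>v u) (?D *\<^sub>v v)"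
    if u: "u \<in> carrier_vec (2 * n + 1)" and v: "v \<in> carrier_vec (2 * n + 1)" for u v
  proof -
    define s where "s = (\<Sum>i = 1..n. u $ (2 * i - 1) * v $ (2 * i) - u $ (2 * i) * v $ (2 * i - 1))"
    have br: "heis_bracket n u v = s \<cdot>\<^sub>v heis_z n"
      by (simp only: heis_bracket_def s_def)
    have z: "heis_z n \<in> carrier_vec (2 * n + 1)"
      by (simp add: heis_z_def)
    have "?D *\<^sub>v heis_bracket n u v = s \<cdot>\<^sub>v (?D *\<^sub>v heis_z n)"
      unfolding br by (rule mult_mat_vec[OF heis_D_carrier z])
    also have "\<dots> = s \<cdot>\<^sub>v ((a * d - b * c) \<cdot>\<^sub>v heis_z n)"
      using heis_D_basis(1)[of n n] assms by simp
    also have "\<dots> = (a * d - b * c) \<cdot>\<^sub>v heis_bracket n u v"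
      by (simp add: br smult_smult_assoc mult.commute)
    also have "\<dots> = heis_bracket n (?D *\<^sub>v u) (?D *\<^sub>v v)"
      by (rule heis_bracket_heis_D[OF u v, symmetric])
    finally show ?thesis .
  qed
  then have "multiplicative (\<lambda>v. ?D *\<^sub>v v)"
    unfolding multiplicative_def by (simp add: module_vec_simps)
  ultimately show ?thesis
    unfolding HLie_m_def by blast
qed

end
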